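(* Let $G$ be a finite, simple, connected graph with $|V(G)| = n$ and vertex connectivity $\kappa(G)$, and let $k$ be an integer with $2 \leq k \leq n - \kappa(G)$. Then $T_k(G)$, together with $n$, uniquely determines $\kappa(G)$: for every finite, simple, connected graph $G'$ with $|V(G')| = n$ and $T_k(G') = T_k(G)$, we have $\kappa(G') = \kappa(G)$.
   Context: Graphs are finite, simple, connected and labeled. For $k \geq 2$ and a graph $G$, the set of connected $k$-sets is $T_k(G) = \{X \subseteq V(G) : |X| = k \text{ and the subgraph of } G \text{ induced by } X \text{ is connected}\}$. $\kappa(G)$ is the vertex connectivity of $G$. *)

theory Defs
  imports "Graph_Theory.Digraph_Component"
begin

text \<open>
  A finite simple undirected graph is the locale \<^locale>\<open>graph\<close>: a finite symmetric digraph without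
  loops and without parallel arcs, an edge being a pair of opposite arcs. The induced subgraph on
  \<open>X\<close> is \<open>G \<restriction> X\<close>. The null graph is not \<open>connected\<close>; a single vertex is.
\<close>

definition connected_sets :: "nat \<Rightarrow> ('a, 'b) pre_digraph \<Rightarrow> 'a set set" where
  "connected_sets k G = {X. X \<subseteq> verts G \<and> card X = k \<and> connected (G \<restriction> X)}"

text \<open>
  The least number of vertices whose deletion leaves a disconnected graph or a single vertex; so the
  complete graph on \<open>n > 0\<close> vertices has connectivity \<open>n - 1\<close>. Since the null graph is not
  \<open>connected\<close>, deleting all vertices also qualifies, but this is never minimal for a nonempty graph.
\<close>

definition vertex_connectivity :: "('a, 'b) pre_digraph \<Rightarrow> nat" where
  "vertex_connectivity G =
    (LEAST c. \<exists>S. S \<subseteq> verts G \<and> card S = c \<and>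
       (\<not> connected (G \<restriction> (verts G - S)) \<or> card (verts G - S) = 1))"

end

theory Submission
  imports Defs
begin

text \<open>
  A set \<open>X\<close> with at least three vertices is connected iff \<open>X - {u}\<close> and \<open>X - {v}\<close> are connected
  for two distinct \<open>u, v \<in> X\<close>: a connected graph has two non-cut vertices, and conversely the two
  sets overlap. So for \<open>k \<ge> 2\<close> the connected \<open>k\<close>-sets determine all larger connected sets. The
  complement of a minimum separating set has \<open>n - \<kappa> \<ge> k\<close> vertices, so whether it is connected is
  already determined.
\<close>

text \<open>If no arc leaves \<open>A\<close>, everything reachable from \<open>A\<close> stays in
  \<open>A\<close>; conversely, the set reachable from a vertex has no outgoing arc, so it cannot be
  proper. Later arguments can thus use cuts instead of walks.\<close>

lemma (in sym_digraph) connected_iff_cut: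
  "connected G \<longleftrightarrow> verts G \<noteq> {} \<and>
    (\<forall>A \<subset> verts G. A \<noteq> {} \<longrightarrow> (\<exists>a \<in> A. \<exists>b \<in> verts G - A. a \<rightarrow>\<^bsub>G\<^esub> b))"
proof (intro iffI conjI allI impI)
  assume "connected G"
  then have strong: "strongly_connected G"
    using symmetric_connected_imp_strongly_connected sym_arcs by blast
  then show "verts G \<noteq> {}" by (simp add: strongly_connected_def)
  fix A assume A: "A \<subset> verts G" "A \<noteq> {}"
  then obtain a b where ab: "a \<in> A" "a \<in> verts G" "b \<in> verts G - A" by blast
  show "\<exists>a \<in> A. \<exists>b \<in> verts G - A. a \<rightarrow>\<^bsub>G\<^esub> b"
  proof (rule ccontr)
    assume *: "\<not> ?thesis"
    have "a \<rightarrow>\<^sup>* b" using strong ab by auto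
    then have "b \<in> A"
      using * ab(1) by (induct rule: reachable_induct) (use adj_in_verts in blast)+
    with ab show False by blast
  qed
next
  assume cut: "verts G \<noteq> {} \<and>
    (\<forall>A \<subset> verts G. A \<noteq> {} \<longrightarrow> (\<exists>a \<in> A. \<exists>b \<in> verts G - A. a \<rightarrow>\<^bsub>G\<^esub> b))"
  have "{v. u \<rightarrow>\<^sup>* v} = verts G" if "u \<in> verts G" for u
  proof (rule ccontr)
    assume "{v. u \<rightarrow>\<^sup>* v} \<noteq> verts G"
    then have "{v. u \<rightarrow>\<^sup>* v} \<subset> verts G" using reachable_in_verts by blast
    moreover have "u \<in> {v. u \<rightarrow>\<^sup>* v}" using that by simp
    ultimately obtain a b where "u \<rightarrow>\<^sup>* a" "\<not> u \<rightarrow>\<^sup>* b" "a \<rightarrow> b"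
      using cut by blast
    then show False using reachable_adj_trans by blast
  qed
  then have "u \<rightarrow>\<^sup>* v" if "u \<in> verts G" "v \<in> verts G" for u v using that by blast
  then show "connected G"
    using cut by (intro connectedI reachable_mk_symmetricI) simp_all
qed

text \<open>Between vertices of \<open>X\<close>, adjacency in \<open>G \<restriction> X\<close> is
  adjacency in \<open>G\<close>. Different induced subgraphs can therefore be compared through the
  arcs of \<open>G\<close> alone.\<close>

lemma (in sym_digraph) connected_induce_iff_cut:
  assumes "X \<subseteq> verts G"
  shows "connected (G \<restriction> X) \<longleftrightarrow> X \<noteq> {} \<and>
    (\<forall>A \<subset> X. A \<noteq> {} \<longrightarrow> (\<exists>a \<in> A. \<exists>b \<in> X - A. a \<rightarrow>\<^bsub>G\<^esub> b))"
proof -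
  interpret GX: sym_digraph "G \<restriction> X"
    using assms by (intro induced_graph_imp_graph induced_induce)
  have "a \<rightarrow>\<^bsub>G \<restriction> X\<^esub> b \<longleftrightarrow> a \<in> X \<and> b \<in> X \<and> a \<rightarrow>\<^bsub>G\<^esub> b" for a b
    by (auto simp: arcs_ends_def arc_to_ends_def)
  then show ?thesis
    unfolding GX.connected_iff_cut by simp blast
qed

text \<open>Because \<open>A\<close> and \<open>B\<close> share a vertex, a nonempty proper subset
  of the union must properly split \<open>A\<close> or \<open>B\<close>, and an arc crossing that
  split also crosses the union.\<close>

lemma (in sym_digraph) connected_induce_union:
  assumes "A \<subseteq> verts G" "B \<subseteq> verts G" "A \<inter> B \<noteq> {}"
    and "connected (G \<restriction> A)" "connected (G \<restriction> B)"
  shows "connected (G \<restriction> (A \<union> B))"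
proof -
  have "\<exists>a \<in> C. \<exists>b \<in> (A \<union> B) - C. a \<rightarrow>\<^bsub>G\<^esub> b" if C: "C \<subset> A \<union> B" "C \<noteq> {}" for C
  proof -
    have cross: "\<exists>a \<in> C. \<exists>b \<in> D - C. a \<rightarrow>\<^bsub>G\<^esub> b"
      if "D \<subseteq> verts G" "connected (G \<restriction> D)" "C \<inter> D \<subset> D" "C \<inter> D \<noteq> {}" for D
    proof -
      have "\<exists>a \<in> C \<inter> D. \<exists>b \<in> D - C \<inter> D. a \<rightarrow>\<^bsub>G\<^esub> b"
        using that connected_induce_iff_cut by simp
      then show ?thesis by blast
    qed
    have "C \<inter> A \<subset> A \<and> C \<inter> A \<noteq> {} \<or> C \<inter> B \<subset> B \<and> C \<inter> B \<noteq> {}"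
      using C assms(3) by blast
    then show ?thesis
      using cross[of A] cross[of B] assms by blast
  qed
  then show ?thesis
    using assms(1-3) by (subst connected_induce_iff_cut) auto
qed

lemma (in sym_digraph) connected_induce_insert:
  assumes "A \<subseteq> verts G" "connected (G \<restriction> A)" "a \<in> A" "a \<rightarrow>\<^bsub>G\<^esub> b"
  shows "connected (G \<restriction> insert b A)"
proof -
  have ab: "{a, b} \<subseteq> verts G" using assms(4) adj_in_verts by blast
  have "b \<rightarrow>\<^bsub>G\<^esub> a" using assms(4) sym_arcs by (auto simp: symmetric_def sym_def)
  then have "connected (G \<restriction> {a, b})"
    unfolding connected_induce_iff_cut[OF ab] using assms(4) by auto
  then have "connected (G \<restriction> (A \<union> {a, b}))"
    using assms ab by (intro connected_induce_union) auto
  moreover have "A \<union> {a, b} = insert b A" using assms(3) by blast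
  ultimately show ?thesis by simp
qed

text \<open>Grow a connected set from \<open>v\<close>; a maximal proper one misses exactly one vertex.\<close>

lemma (in sym_digraph) obtain_noncut_vertex:
  assumes "X \<subseteq> verts G" "finite X" "connected (G \<restriction> X)" "v \<in> X" "X \<noteq> {v}"
  obtains u where "u \<in> X" "u \<noteq> v" "connected (G \<restriction> (X - {u}))"
proof -
  define F where "F = {A. v \<in> A \<and> A \<subset> X \<and> connected (G \<restriction> A)}"
  \<comment> \<open>A singleton has no nonempty proper subset, so the cut condition is
    vacuous.\<close>
  have "connected (G \<restriction> {v})"
    using assms by (subst connected_induce_iff_cut) auto
  then have "{v} \<in> F" using assms unfolding F_def by auto
  moreover have "finite F"
    using assms(2) unfolding F_def by (auto intro: finite_subset[of _ "Pow X"])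
  ultimately obtain A where A: "A \<in> F" "\<And>B. B \<in> F \<Longrightarrow> A \<subseteq> B \<Longrightarrow> A = B"
    using finite_has_maximal[of F] by blast
  then obtain a u where au: "a \<in> A" "u \<in> X - A" "a \<rightarrow>\<^bsub>G\<^esub> u"
    using assms(3) unfolding F_def connected_induce_iff_cut[OF assms(1)] by blast
  have "connected (G \<restriction> insert u A)"
    using A(1) au assms(1) unfolding F_def by (intro connected_induce_insert) auto
  \<comment> \<open>By maximality of \<open>A\<close>, the larger connected set cannot be a proper
    subset of \<open>X\<close>, so it is all of \<open>X\<close>.\<close>
  moreover have "insert u A \<notin> F" using A(2)[of "insert u A"] au by blast
  ultimately have "insert u A = X" using A(1) au unfolding F_def by blast
  then have "A = X - {u}" using au by blast
  then show thesis using that[of u] A(1) au unfolding F_def by blast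
qed

lemma (in pseudo_graph) mem_connected_sets_Suc_iff:
  assumes "2 \<le> k"
  shows "X \<in> connected_sets (Suc k) G \<longleftrightarrow> card X = Suc k \<and>
    (\<exists>u \<in> X. \<exists>v \<in> X. u \<noteq> v \<and> X - {u} \<in> connected_sets k G \<and> X - {v} \<in> connected_sets k G)"
proof (intro iffI conjI)
  assume "X \<in> connected_sets (Suc k) G"
  then have X: "X \<subseteq> verts G" "card X = Suc k" "connected (G \<restriction> X)"
    unfolding connected_sets_def by auto
  then have fin: "finite X" by (simp add: card_ge_0_finite)
  have large: "X \<noteq> {w}" for w using X(2) assms by auto
  have "X \<noteq> {}" using X(2) by auto
  then obtain w where "w \<in> X" by blast
  then obtain u where u: "u \<in> X" "connected (G \<restriction> (X - {u}))"
    using obtain_noncut_vertex[OF X(1) fin X(3)] large by blast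
  \<comment> \<open>Now \<open>u\<close> is the vertex to be kept, which forces the second non-cut
    vertex to differ from it.\<close>
  then obtain v where v: "v \<in> X" "v \<noteq> u" "connected (G \<restriction> (X - {v}))"
    using obtain_noncut_vertex[OF X(1) fin X(3)] large by blast
  show "\<exists>u \<in> X. \<exists>v \<in> X. u \<noteq> v \<and> X - {u} \<in> connected_sets k G \<and> X - {v} \<in> connected_sets k G"
    using u v X fin unfolding connected_sets_def by (auto simp: card_Diff_singleton)
  show "card X = Suc k" by fact
next
  assume "card X = Suc k \<and>
    (\<exists>u \<in> X. \<exists>v \<in> X. u \<noteq> v \<and> X - {u} \<in> connected_sets k G \<and> X - {v} \<in> connected_sets k G)"
  then obtain u v where card: "card X = Suc k" and uv: "u \<in> X" "v \<in> X" "u \<noteq> v"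
    and conn: "X - {u} \<subseteq> verts G" "connected (G \<restriction> (X - {u}))"
      "X - {v} \<subseteq> verts G" "connected (G \<restriction> (X - {v}))"
    unfolding connected_sets_def by auto
  \<comment> \<open>Here \<open>2 \<le> k\<close> matters: a third vertex of \<open>X\<close> lies
    in both \<open>X - {u}\<close> and \<open>X - {v}\<close>.\<close>
  have "card {u, v} < card X" using card assms uv(3) by simp
  then have "\<not> X \<subseteq> {u, v}" using card_mono[of "{u, v}" X] by auto
  then have "(X - {u}) \<inter> (X - {v}) \<noteq> {}" by blast
  then have "connected (G \<restriction> ((X - {u}) \<union> (X - {v})))"
    using conn by (intro connected_induce_union) auto
  moreover have "(X - {u}) \<union> (X - {v}) = X" using uv by blast
  ultimately show "X \<in> connected_sets (Suc k) G"
    using card conn(1,3) unfolding connected_sets_def by auto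
qed

lemma connected_sets_eq_mono:
  assumes "pseudo_graph G" "pseudo_graph G'" "2 \<le> k" "k \<le> m"
    and "connected_sets k G' = connected_sets k G"
  shows "connected_sets m G' = connected_sets m G"
  using assms(4)
proof (induction rule: dec_induct)
  case base
  show ?case by fact
next
  case (step m)
  then have "2 \<le> m" using assms(3) by simp
  then show ?case
    using step.IH pseudo_graph.mem_connected_sets_Suc_iff[OF assms(1)]
      pseudo_graph.mem_connected_sets_Suc_iff[OF assms(2)]
    by (intro set_eqI) simp
qed

text \<open>Since \<open>G\<close> is connected, its whole vertex set is one of the connected sets,
  hence lies inside \<open>verts G'\<close>; equal finite cardinalities then force equality.\<close>

lemma verts_eq_if_connected_sets_eq:
  assumes "wf_digraph G" "connected G" "finite (verts G')" "card (verts G) = card (verts G')"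
    and "connected_sets (card (verts G)) G' = connected_sets (card (verts G)) G"
  shows "verts G' = verts G"
proof -
  interpret wf_digraph G by fact
  have "G \<restriction> verts G = G" by (intro pre_digraph.equality) auto
  then have "connected (G \<restriction> verts G)" using assms(2) by simp
  then have "verts G \<in> connected_sets (card (verts G)) G'"
    unfolding assms(5) by (simp add: connected_sets_def)
  then show ?thesis
    using assms(3,4) by (auto simp: connected_sets_def dest: card_subset_eq)
qed

lemma obtain_separating_set:
  obtains S where "S \<subseteq> verts G" "card S = vertex_connectivity G"
    "\<not> connected (G \<restriction> (verts G - S)) \<or> card (verts G - S) = 1"
proof -
  \<comment> \<open>Deleting all vertices is always a candidate, so the \<open>LEAST\<close> is
    attained.\<close>
  have "\<not> connected (G \<restriction> {})"
    by (simp add: connected_def strongly_connected_def mk_symmetric_def)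
  then have "\<exists>S. S \<subseteq> verts G \<and> card S = card (verts G) \<and>
       (\<not> connected (G \<restriction> (verts G - S)) \<or> card (verts G - S) = 1)"
    by (intro exI[of _ "verts G"]) simp
  from LeastI[of "\<lambda>c. \<exists>S. S \<subseteq> verts G \<and> card S = c \<and>
       (\<not> connected (G \<restriction> (verts G - S)) \<or> card (verts G - S) = 1)", OF this]
  show thesis using that unfolding vertex_connectivity_def by blast
qed

lemma vertex_connectivity_le_if_connected_sets_eq:
  assumes "finite (verts G)" "verts G' = verts G"
    and "2 \<le> card (verts G) - vertex_connectivity G"
    and "\<And>m. card (verts G) - vertex_connectivity G \<le> m \<Longrightarrow>
      connected_sets m G' = connected_sets m G"
  shows "vertex_connectivity G' \<le> vertex_connectivity G"
proof -
  obtain S where S: "S \<subseteq> verts G" "card S = vertex_connectivity G"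
    "\<not> connected (G \<restriction> (verts G - S)) \<or> card (verts G - S) = 1"
    using obtain_separating_set by blast
  have card: "card (verts G - S) = card (verts G) - vertex_connectivity G"
    using S(1,2) assms(1) by (simp add: card_Diff_subset finite_subset)
  \<comment> \<open>At least two vertices remain, which excludes the single-vertex alternative:
    \<open>S\<close> really separates \<open>G\<close>.\<close>
  then have "\<not> connected (G \<restriction> (verts G - S))" using S(3) assms(3) by auto
  then have "verts G - S \<notin> connected_sets (card (verts G - S)) G'"
    using assms(4) card by (simp add: connected_sets_def)
  then have "\<not> connected (G' \<restriction> (verts G' - S))"
    using assms(2) by (simp add: connected_sets_def)
  then show ?thesis
    unfolding vertex_connectivity_def[of G']
    using S(1,2) assms(2) by (intro Least_le) auto
qed

theorem theorem2p2:
  fixes G :: "('a, 'b) pre_digraph" and G' :: "('a, 'c) pre_digraph" and n k :: nat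
  assumes "graph G" and "connected G" and "card (verts G) = n"
    and "2 \<le> k" and "k \<le> n - vertex_connectivity G"
    and "graph G'" and "connected G'" and "card (verts G') = n"
    and "connected_sets k G' = connected_sets k G"
  shows "vertex_connectivity G' = vertex_connectivity G"
proof -
  interpret G: graph G by fact
  interpret G': graph G' by fact
  have sets: "connected_sets m G' = connected_sets m G" if "k \<le> m" for m
    using connected_sets_eq_mono[OF G.pseudo_graph_axioms G'.pseudo_graph_axioms assms(4) that assms(9)] .
  \<comment> \<open>This makes \<open>sets\<close> available at size \<open>n\<close>, where the
    vertex set itself is a connected set.\<close>
  have "k \<le> card (verts G)" using assms(3,5) by simp
  then have verts: "verts G' = verts G"
    using verts_eq_if_connected_sets_eq[OF G.wf_digraph_axioms assms(2) G'.finite_verts] assms(3,8) sets by simp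
  have le: "vertex_connectivity G' \<le> vertex_connectivity G"
    using assms(3-5) verts sets by (intro vertex_connectivity_le_if_connected_sets_eq) auto
  \<comment> \<open>The roles are swapped. The bound on \<open>k\<close> is assumed for
    \<open>G\<close> only, but \<open>le\<close> gives \<open>k \<le> n - vertex_connectivity G
    \<le> n - vertex_connectivity G'\<close>.\<close>
  moreover have "vertex_connectivity G \<le> vertex_connectivity G'"
    using assms(3-5,8) verts sets le by (intro vertex_connectivity_le_if_connected_sets_eq) auto
  ultimately show ?thesis by simp
qed

end
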